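(* Let $\mathbb{F}$ be a field (finite or infinite) and let $n\ge1$ be an integer. Then $\gamma(TD(\mathbb{F},n))$ is finite if and only if $\mathbb{F}$ is a finite field.
   Context: For a commutative ring $R$ with nonzero identity and an integer $n\ge1$, $TD(R,n)$ is the simple graph with vertex set $R^n\setminus\{(0,\ldots,0)\}$ in which two distinct vertices $\mathbf{x},\mathbf{y}$ are adjacent if and only if $\mathbf{x}\cdot\mathbf{y}=\sum_{i=1}^n x_iy_i=0$ in $R$. A set $D$ of vertices of a graph $G$ is dominating if every vertex of $V(G)\setminus D$ is adjacent to a vertex of $D$; the domination number $\gamma(G)$ is the minimum cardinality of a dominating set of $G$, so $\gamma(G)$ is finite if and only if $G$ has a finite dominating set. *)

theory Defs
  imports "HOL-Library.Extended_Nat" "Jordan_Normal_Form.Matrix"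
begin

text \<open>
  Undirected graphs are given by a vertex set and a set of edges, each edge being
  the set of its two end points; the vertex set may be infinite.
\<close>

record 'v ugraph =
  vertices :: "'v set"
  edges :: "'v set set"

definition simple_graph :: "'v ugraph \<Rightarrow> bool" where
  "simple_graph G \<longleftrightarrow> (\<forall>e \<in> edges G. e \<subseteq> vertices G \<and> card e = 2)"

definition adjacent :: "'v ugraph \<Rightarrow> 'v \<Rightarrow> 'v \<Rightarrow> bool" where
  "adjacent G x y \<longleftrightarrow> {x, y} \<in> edges G"

definition dominating :: "'v ugraph \<Rightarrow> 'v set \<Rightarrow> bool" where
  "dominating G D \<longleftrightarrow>
     D \<subseteq> vertices G \<and> (\<forall>v \<in> vertices G - D. \<exists>d \<in> D. adjacent G v d)"

text \<open>
  All infinite cardinalities are identified with \<open>\<infinity>\<close>; note that \<open>card D = 0\<close> for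
  infinite \<open>D\<close>, so the case distinction is needed.
\<close>

definition ecard :: "'v set \<Rightarrow> enat" where
  "ecard D = (if finite D then enat (card D) else \<infinity>)"

text \<open>
  The infimum is a minimum: \<open>enat\<close> is well-ordered, and the whole vertex set is dominating.
\<close>

definition domination_number :: "'v ugraph \<Rightarrow> enat" where
  "domination_number G = (INF D \<in> {D. dominating G D}. ecard D)"

definition TD :: "nat \<Rightarrow> 'a :: comm_ring_1 vec ugraph" where
  "TD n =
     \<lparr> vertices = carrier_vec n - {0\<^sub>v n},
       edges = {{x, y} | x y. x \<in> carrier_vec n - {0\<^sub>v n} \<and> y \<in> carrier_vec n - {0\<^sub>v n} \<and>
                              x \<noteq> y \<and> x \<bullet> y = 0} \<rparr>"

lemma simple_graph_TD: "simple_graph (TD n)"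
  by (auto simp: simple_graph_def TD_def)

lemma adjacent_TD_iff:
  fixes x y :: "'a :: comm_ring_1 vec"
  shows "adjacent (TD n) x y \<longleftrightarrow>
    x \<in> vertices (TD n) \<and> y \<in> vertices (TD n) \<and> x \<noteq> y \<and> x \<bullet> y = 0"
  by (auto simp: adjacent_def TD_def doubleton_eq_iff comm_scalar_prod)

lemma domination_number_attained:
  "\<exists>D. dominating G D \<and> domination_number G = ecard D"
proof -
  have "dominating G (vertices G)"
    by (simp add: dominating_def)
  then have "ecard ` {D. dominating G D} \<noteq> {}"
    by blast
  then have "Inf (ecard ` {D. dominating G D}) \<in> ecard ` {D. dominating G D}"
    by (auto simp: Inf_enat_def intro: LeastI)
  then show ?thesis
    by (auto simp: domination_number_def)
qed

lemma domination_number_finite_iff: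
  "domination_number G < \<infinity> \<longleftrightarrow> (\<exists>D. dominating G D \<and> finite D)"
  unfolding domination_number_def INF_less_iff by (auto simp: ecard_def split: if_splits)

end

theory Submission
  imports Defs "HOL-Computational_Algebra.Polynomial" "HOL-Library.FuncSet"
begin

text \<open>
  Over a finite field the vertex set itself is a finite dominating set. Over an infinite field no
  finite set \<open>D\<close> of vertices dominates, because the curve \<open>t \<mapsto> (t, t\<^sup>2, \<dots>, t\<^sup>n)\<close> escapes from
  \<open>D\<close>: it meets the hyperplane orthogonal to a nonzero \<open>d\<close> exactly at the roots of the nonzero
  polynomial \<open>d\<^sub>1 t + \<dots> + d\<^sub>n t\<^sup>n\<close>, hence at finitely many parameters
  (\<open>finite_moment_curve_orthogonal\<close>), and it runs through the point \<open>d\<close> only for \<open>t = d\<^sub>1\<close>.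
  So finitely many \<open>d\<close> exclude finitely many parameters, and any other \<open>t \<noteq> 0\<close>
  gives a vertex that is neither in \<open>D\<close> nor adjacent to a member of \<open>D\<close>.
\<close>

text \<open>
  The exponents start at \<open>1\<close> rather than at \<open>0\<close>: the first coordinate is then the parameter, so
  the curve is injective even in dimension \<open>1\<close>, where \<open>(1, t, \<dots>, t\<^sup>n\<^sup>-\<^sup>1)\<close> would be constant.
\<close>

definition moment_curve :: "nat \<Rightarrow> 'a :: comm_ring_1 \<Rightarrow> 'a vec" where
  "moment_curve n t = vec n (\<lambda>i. t ^ Suc i)"

lemma moment_curve_carrier [simp]: "moment_curve n t \<in> carrier_vec n"
  by (simp add: moment_curve_def)

lemma moment_curve_first:
  assumes "n \<ge> 1"
  shows "moment_curve n t $ 0 = t"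
  using assms by (simp add: moment_curve_def)

lemma finite_moment_curve_orthogonal:
  fixes d :: "'a :: field vec"
  assumes "d \<in> carrier_vec n" "d \<noteq> 0\<^sub>v n"
  shows "finite {t. moment_curve n t \<bullet> d = 0}"
proof -
  define p where "p = (\<Sum>i<n. monom (d $ i) (Suc i))"
  have "poly p t = moment_curve n t \<bullet> d" for t
    using assms(1)
    by (simp add: p_def poly_sum poly_monom scalar_prod_def moment_curve_def
        atLeast0LessThan mult.commute)
  moreover have "p \<noteq> 0"
  proof
    assume "p = 0"
    have "d $ i = coeff p (Suc i)" if "i < n" for i
      using that by (simp add: p_def coeff_sum sum.delta)
    then have "d = 0\<^sub>v n"
      using assms(1) \<open>p = 0\<close> by (intro eq_vecI) auto
    with assms(2) show False ..
  qed
  ultimately show ?thesis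
    using poly_roots_finite[of p] by simp
qed

lemma finite_dominating_TD_imp_finite_field:
  fixes D :: "'a :: field vec set"
  assumes "n \<ge> 1" and dom: "dominating (TD n) D" and "finite D"
  shows "finite (UNIV :: 'a set)"
proof -
  have D: "d \<in> carrier_vec n" "d \<noteq> 0\<^sub>v n" if "d \<in> D" for d
    using dom that by (auto simp: dominating_def TD_def)
  \<comment> \<open>The parameter \<open>0\<close> is bad because the curve passes through the origin, which is no vertex.\<close>
  define B where "B = insert 0 (\<Union>d\<in>D. insert (d $ 0) {t. moment_curve n t \<bullet> d = 0})"
  have "t \<in> B" for t
  proof (rule ccontr)
    assume "t \<notin> B"
    let ?x = "moment_curve n t"
    have "?x \<noteq> 0\<^sub>v n"
      using \<open>t \<notin> B\<close> moment_curve_first[OF \<open>n \<ge> 1\<close>, of t] \<open>n \<ge> 1\<close> by (auto simp: B_def)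
    then have "?x \<in> vertices (TD n)"
      by (simp add: TD_def)
    moreover have "?x \<notin> D"
      using \<open>t \<notin> B\<close> moment_curve_first[OF \<open>n \<ge> 1\<close>, of t] by (force simp: B_def)
    ultimately obtain d where "d \<in> D" "adjacent (TD n) ?x d"
      using dom by (auto simp: dominating_def)
    with \<open>t \<notin> B\<close> show False
      by (simp add: B_def adjacent_TD_iff)
  qed
  then have "UNIV = B"
    by blast
  moreover have "finite B"
    using \<open>finite D\<close> D finite_moment_curve_orthogonal by (auto simp: B_def)
  ultimately show ?thesis
    by simp
qed

lemma finite_carrier_vec_UNIV:
  assumes "finite (UNIV :: 'a set)"
  shows "finite (carrier_vec n :: 'a vec set)"
proof (rule finite_subset)
  show "carrier_vec n \<subseteq> vec n ` ({..<n} \<rightarrow>\<^sub>E (UNIV :: 'a set))"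
  proof
    fix v :: "'a vec"
    assume "v \<in> carrier_vec n"
    then have "v = vec n (restrict (($) v) {..<n})"
      by (intro eq_vecI) auto
    then show "v \<in> vec n ` ({..<n} \<rightarrow>\<^sub>E UNIV)"
      by (rule image_eqI[of v "vec n"]) simp
  qed
  show "finite (vec n ` ({..<n} \<rightarrow>\<^sub>E (UNIV :: 'a set)))"
    using assms by (intro finite_imageI finite_PiE) auto
qed

theorem theorem3p6:
  fixes n :: nat
  assumes "n \<ge> 1"
  shows "domination_number (TD n :: 'a :: field vec ugraph) < \<infinity> \<longleftrightarrow> finite (UNIV :: 'a set)"
proof
  assume "domination_number (TD n :: 'a vec ugraph) < \<infinity>"
  then show "finite (UNIV :: 'a set)"
    unfolding domination_number_finite_iff
    using finite_dominating_TD_imp_finite_field[OF assms] by blast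
next
  assume fin: "finite (UNIV :: 'a set)"
  let ?G = "TD n :: 'a vec ugraph"
  have "dominating ?G (vertices ?G)"
    by (simp add: dominating_def)
  moreover have "finite (vertices ?G)"
    using finite_carrier_vec_UNIV[OF fin, of n] by (simp add: TD_def)
  ultimately show "domination_number ?G < \<infinity>"
    unfolding domination_number_finite_iff by blast
qed

end
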